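(* Let $\mathcal H$ be a nonzero real Hilbert space, let $L>0$, and let $f:\mathcal H\to\mathbb R$ be convex, differentiable and $L$-smooth. Let $x_\star\in\mathcal H$ be a minimizer of $f$. Fix an integer $N\ge 1$ and $R\ge 0$, and let $x_0\in\mathcal H$ satisfy $\|x_0-x_\star\|\le R$. Let $\theta_0=1$ and $\theta_{k+1}=\frac{1+\sqrt{1+4\theta_k^2}}{2}$ for $k\ge 0$. Starting from $x_0=y_0=z_0$, define for $0\le k<N$ $$y_{k+1}=x_k-\tfrac1L\nabla f(x_k),\qquad z_{k+1}=z_k-\tfrac{\theta_k}{L}\nabla f(x_k),\qquad x_{k+1}=\Bigl(1-\tfrac1{\theta_{k+1}}\Bigr)y_{k+1}+\tfrac1{\theta_{k+1}}z_{k+1}.$$ Then $$f(y_N)-f(x_\star)\le \frac{LR^2\,\theta_{N-1}^2}{2\left(2\sum_{j=0}^{N-1}\theta_j^3+\theta_{N-1}^2\right)}.$$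
   Context: $L$-smooth means $\|\nabla f(x)-\nabla f(y)\|\le L\|x-y\|$ for all $x,y\in\mathcal H$. The iteration is Nesterov's fast gradient method (FGM). *)

theory Defs
  imports "HOL-Analysis.Analysis"
begin

text \<open>The Riesz representative of the Frechet derivative. It is a meaningful object at \<open>x\<close>
  only if \<open>f\<close> is differentiable at \<open>x\<close>; existence then needs completeness of the space.\<close>

definition gradient :: "('a::{real_inner, complete_space} \<Rightarrow> real) \<Rightarrow> 'a \<Rightarrow> 'a"
  where "gradient f x = (THE D. GDERIV f x :> D)"

text \<open>Differentiability is not part of this notion and has to be assumed separately.\<close>

definition L_smooth :: "real \<Rightarrow> ('a::{real_inner, complete_space} \<Rightarrow> real) \<Rightarrow> bool"
  where "L_smooth L f \<longleftrightarrow> (\<forall>x y. norm (gradient f x - gradient f y) \<le> L * norm (x - y))"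

primrec theta :: "nat \<Rightarrow> real"
  where
    "theta 0 = 1"
  | "theta (Suc k) = (1 + sqrt (1 + 4 * (theta k)\<^sup>2)) / 2"

text \<open>\<open>N\<close> steps of the fast gradient method; the values of the sequences beyond index \<open>N\<close>
  are unconstrained.\<close>

definition is_FGM ::
  "real \<Rightarrow> ('a::{real_inner, complete_space} \<Rightarrow> real) \<Rightarrow> nat
    \<Rightarrow> (nat \<Rightarrow> 'a) \<Rightarrow> (nat \<Rightarrow> 'a) \<Rightarrow> (nat \<Rightarrow> 'a) \<Rightarrow> bool"
  where
    "is_FGM L f N x y z \<longleftrightarrow>
      y 0 = x 0 \<and> z 0 = x 0 \<and>
      (\<forall>k<N.
        y (Suc k) = x k - (1 / L) *\<^sub>R gradient f (x k) \<and>
        z (Suc k) = z k - (theta k / L) *\<^sub>R gradient f (x k) \<and>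
        x (Suc k) = (1 - 1 / theta (Suc k)) *\<^sub>R y (Suc k) + (1 / theta (Suc k)) *\<^sub>R z (Suc k))"

end

theory Submission
  imports Defs
begin

text \<open>
  Divide \<open>f\<close> by \<open>L\<close>, let \<open>p\<^sub>t = x\<^sub>t\<close> for \<open>t < N\<close> and \<open>p\<^sub>N = y\<^sub>N\<close>, and let \<open>g\<^sub>t\<close> and \<open>\<phi>\<^sub>t\<close> be the scaled
  gradient and the scaled excess value \<open>(f(p\<^sub>t) - f(x\<^sub>\<star>)) / L\<close> there. A smooth convex function satisfies
  the interpolation inequality \<open>smooth_convex_interpolation\<close> between any two points. Only \<open>2 N + 1\<close> of
  these inequalities enter: those between \<open>x\<^sub>\<star>\<close> and each \<open>p\<^sub>t\<close>, with weights \<open>c\<^sub>t\<close>, and those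
  between \<open>p\<^sub>t\<^sub>-\<^sub>1\<close> and \<open>p\<^sub>t\<close>, with weights \<open>B\<^sub>t = \<Sum>\<^sub>i\<^sub><\<^sub>t c\<^sub>i\<close>. With these weights the function values
  telescope to \<open>A \<phi>\<^sub>N\<close>, where \<open>A = \<Sum>\<^sub>i c\<^sub>i\<close>. The terms that involve \<open>x\<^sub>0 - x\<^sub>\<star>\<close> are completed to
  a square, and a quadratic form in \<open>g\<^sub>0, \<dots>, g\<^sub>N\<close> remains.

  The candidate for the worst function is a Huber function whose gradient is constant along the
  run. For it all these inequalities are equalities, so the quadratic form has to vanish when all \<open>g\<^sub>t\<close> agree. This
  fixes \<open>A\<close> and every \<open>B\<^sub>t\<close>. With \<open>s\<^sub>k = \<Sum>\<^sub>i\<^sub><\<^sub>k \<theta>\<^sub>i\<close>, which is \<open>\<theta>\<^sub>k\<^sub>-\<^sub>1\<^sup>2\<close> for \<open>k \<ge> 1\<close>, and \<open>r\<^sub>k = (\<Sum>\<^sub>i\<^sub><\<^sub>k \<theta>\<^sub>i\<^sup>2) / s\<^sub>k\<close>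
  the result is
  \<open>A = s\<^sub>N + r\<^sub>N + 1\<close> and \<open>B\<^sub>k = s\<^sub>k A (2 s\<^sub>N - s\<^sub>k + r\<^sub>k) / (s\<^sub>N (2 A - s\<^sub>k - r\<^sub>k))\<close> for \<open>k \<le> N\<close>.

  A form that vanishes on equal arguments in this way is \<open>- \<Sum>\<^sub>i\<^sub><\<^sub>t m\<^sub>i\<^sub>t \<parallel>g\<^sub>i - g\<^sub>t\<parallel>\<^sup>2 / 2\<close> for suitable
  numbers \<open>m\<^sub>i\<^sub>t\<close>, and the proof is complete once they are nonnegative. Here they are sums of two
  products whose factors are nonnegative as soon as \<open>B\<^sub>k / s\<^sub>k\<close> is nondecreasing in \<open>k\<close>. This
  monotonicity, \<open>chain_ratio_mono\<close>, is the one delicate estimate; it rests on \<open>3 r\<^sub>k \<le> 2 \<theta>\<^sub>k\<close>. The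
  algebraic part is \<open>pair_weight_balance\<close>, and \<open>weighted_interpolation_bound\<close> assembles the
  pieces into \<open>A \<phi>\<^sub>N \<le> \<parallel>x\<^sub>0 - x\<^sub>\<star>\<parallel>\<^sup>2 / 2\<close>. Finally \<open>A = 2 (\<Sum>\<^sub>j\<^sub><\<^sub>N \<theta>\<^sub>j\<^sup>3) / \<theta>\<^sub>N\<^sub>-\<^sub>1\<^sup>2 + 1\<close> by \<open>cube_sum\<close>.
\<close>

section \<open>Gradients of smooth convex functions\<close>

text \<open>The representative minimises \<open>(norm x)\<^sup>2 - 2 * l x\<close>. By the parallelogram identity every minimising
  sequence is a Cauchy sequence, so completeness yields a minimiser, and stationarity there
  is the claim.\<close>

lemma riesz_representation:
  fixes l :: "'a::{real_inner, complete_space} \<Rightarrow> real"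
  assumes l: "bounded_linear l"
  shows "\<exists>D. \<forall>h. l h = inner h D"
proof -
  interpret bounded_linear l by fact
  obtain K where K: "\<And>x. norm (l x) \<le> norm x * K" using bounded by blast
  define J where "J x = (norm x)\<^sup>2 - 2 * l x" for x
  have J_lower: "- K\<^sup>2 \<le> J x" for x
  proof -
    have "l x \<le> norm x * K" using K[of x] by simp
    moreover have "0 \<le> (norm x - K)\<^sup>2" by simp
    ultimately show ?thesis by (simp add: J_def power2_eq_square algebra_simps)
  qed
  then have bdd: "bdd_below (range J)" by (intro bdd_belowI[of _ "- K\<^sup>2"]) auto
  define \<mu> where "\<mu> = (INF x. J x)"
  have \<mu>_le: "\<mu> \<le> J x" for x unfolding \<mu>_def by (intro cINF_lower bdd) simp
  have "\<exists>x. J x < \<mu> + inverse (real (Suc n))" for n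
    using cInf_lessD[of "range J" "\<mu> + inverse (real (Suc n))"] by (auto simp: \<mu>_def)
  then obtain X where X: "J (X n) < \<mu> + inverse (real (Suc n))" for n by metis
  have gap: "(norm (x - y))\<^sup>2 = 2 * J x + 2 * J y - 4 * J ((1 / 2) *\<^sub>R (x + y))" for x y
    by (simp add: J_def power2_norm_eq_inner inner_add inner_diff inner_commute add diff scaleR
        algebra_simps)
  have "Cauchy X"
  proof (rule metric_CauchyI)
    fix e :: real assume e: "0 < e"
    then obtain M where M: "inverse (real (Suc M)) < e\<^sup>2 / 4"
      using reals_Archimedean[of "e\<^sup>2 / 4"] by auto
    have "dist (X m) (X n) < e" if "M \<le> m" "M \<le> n" for m n
    proof -
      have "inverse (real (Suc k)) \<le> inverse (real (Suc M))" if "M \<le> k" for k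
        using that by (intro le_imp_inverse_le) auto
      then have "J (X m) < \<mu> + e\<^sup>2 / 4" "J (X n) < \<mu> + e\<^sup>2 / 4"
        using X[of m] X[of n] that M
        by (meson add_left_mono add_strict_left_mono less_le_trans less_trans)+
      then have "(norm (X m - X n))\<^sup>2 < e\<^sup>2"
        using gap[of "X m" "X n"] \<mu>_le[of "(1 / 2) *\<^sub>R (X m + X n)"] by linarith
      then show ?thesis
        using e by (simp add: dist_norm power2_less_imp_less)
    qed
    then show "\<exists>M. \<forall>m\<ge>M. \<forall>n\<ge>M. dist (X m) (X n) < e" by blast
  qed
  then obtain D where D: "X \<longlonglongrightarrow> D" using Cauchy_convergent_iff convergent_def by blast
  have "(\<lambda>n. J (X n)) \<longlonglongrightarrow> J D"
    unfolding J_def by (intro tendsto_intros D tendsto)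
  moreover have "(\<lambda>n. \<mu> + inverse (real (Suc n))) \<longlonglongrightarrow> \<mu> + 0"
    by (intro tendsto_intros LIMSEQ_inverse_real_of_nat)
  ultimately have "J D \<le> \<mu> + 0"
    by (rule LIMSEQ_le) (use X in \<open>auto intro!: exI[of _ 0] less_imp_le\<close>)
  then have D_min: "J D \<le> J x" for x using \<mu>_le[of x] by simp
  have "l h = inner h D" for h
  proof -
    (* The perturbation of D along h by e * d lowers J by about 2 * e * d\<^sup>2; this e is
       small enough for the quadratic term to take back at most half of it. *)
    define d where "d = l h - inner h D"
    define e where "e = 1 / (1 + (norm h)\<^sup>2)"
    have e: "0 < e" "e * (norm h)\<^sup>2 \<le> 1" by (simp_all add: e_def divide_simps add_pos_nonneg)
    have "J (D + a *\<^sub>R h) - J D = a\<^sup>2 * (norm h)\<^sup>2 - 2 * a * d" for a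
      unfolding J_def d_def power2_norm_eq_inner inner_add add scaleR
      by (simp add: inner_commute power2_eq_square algebra_simps)
    moreover have "0 \<le> J (D + (e * d) *\<^sub>R h) - J D" using D_min by simp
    moreover have "(e * d)\<^sup>2 * (norm h)\<^sup>2 - 2 * (e * d) * d = (e * d\<^sup>2) * (e * (norm h)\<^sup>2 - 2)"
      by (simp add: power2_eq_square algebra_simps)
    ultimately have "0 \<le> (e * d\<^sup>2) * (e * (norm h)\<^sup>2 - 2)" by metis
    moreover have "(e * d\<^sup>2) * (e * (norm h)\<^sup>2 - 2) \<le> (e * d\<^sup>2) * (- 1)"
      using e by (intro mult_left_mono) auto
    ultimately have "e * d\<^sup>2 \<le> 0" by simp
    then show ?thesis using e by (simp add: mult_le_0_iff d_def)
  qed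
  then show ?thesis by blast
qed

lemma has_derivative_gradient:
  fixes f :: "'a::{real_inner, complete_space} \<Rightarrow> real"
  assumes "f differentiable (at x)"
  shows "(f has_derivative (\<lambda>h. inner h (gradient f x))) (at x)"
proof -
  obtain l where l: "(f has_derivative l) (at x)" using assms differentiable_def by blast
  then obtain D where "\<And>h. l h = inner h D"
    using riesz_representation has_derivative_bounded_linear by metis
  then have "l = (\<lambda>h. inner h D)" by auto
  then have D: "GDERIV f x :> D" using l by (simp add: gderiv_def)
  have "E = D" if "GDERIV f x :> E" for E
  proof -
    have "(\<lambda>h. inner h E) = (\<lambda>h. inner h D)"
      using that D unfolding gderiv_def by (rule has_derivative_unique)
    then have "inner (E - D) E = inner (E - D) D" by meson
    then have "inner (E - D) (E - D) = 0" by (simp add: inner_diff_right)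
    then show ?thesis by simp
  qed
  with D have "GDERIV f x :> gradient f x"
    unfolding gradient_def by (rule theI)
  then show ?thesis by (simp add: gderiv_def)
qed

context
  fixes f :: "'a::{real_inner, complete_space} \<Rightarrow> real" and L :: real
  assumes diff: "\<forall>u. f differentiable (at u)"
begin

lemma DERIV_along_line:
  "((\<lambda>t. f (u + t *\<^sub>R w)) has_real_derivative inner w (gradient f (u + t *\<^sub>R w))) (at t)"
proof -
  have "((\<lambda>t. u + t *\<^sub>R w) has_derivative (\<lambda>h. h *\<^sub>R w)) (at t)"
    by (auto intro!: derivative_eq_intros)
  then have "((\<lambda>t. f (u + t *\<^sub>R w)) has_derivative (\<lambda>h. inner (h *\<^sub>R w) (gradient f (u + t *\<^sub>R w)))) (at t)"
    using has_derivative_gradient[OF diff[rule_format]] by (rule has_derivative_compose)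
  then show ?thesis
    by (simp add: has_field_derivative_def mult_commute_abs)
qed

text \<open>The derivative of \<open>t \<mapsto> f (u + t w) - t \<langle>w, \<nabla>f(u)\<rangle> - L t\<^sup>2 \<parallel>w\<parallel>\<^sup>2 / 2\<close> is nonpositive for \<open>t \<ge> 0\<close>, by the
  Lipschitz bound on the gradient.\<close>

lemma descent:
  assumes "L_smooth L f"
  shows "f (u + w) \<le> f u + inner w (gradient f u) + L / 2 * (norm w)\<^sup>2"
proof -
  define \<psi> where "\<psi> t = f (u + t *\<^sub>R w) - t * inner w (gradient f u) - t\<^sup>2 * (L / 2 * (norm w)\<^sup>2)" for t
  have "\<psi> 1 \<le> \<psi> 0"
  proof (rule DERIV_nonpos_imp_nonincreasing[where f = \<psi> and a = 0 and b = 1])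
    fix t :: real assume t: "0 \<le> t"
    let ?d = "inner w (gradient f (u + t *\<^sub>R w)) - inner w (gradient f u) - 2 * t * (L / 2 * (norm w)\<^sup>2)"
    have "(\<psi> has_real_derivative ?d) (at t)"
      unfolding \<psi>_def by (auto intro!: derivative_eq_intros DERIV_along_line)
    moreover have "inner w (gradient f (u + t *\<^sub>R w) - gradient f u)
        \<le> norm w * norm (gradient f (u + t *\<^sub>R w) - gradient f u)"
      by (rule norm_cauchy_schwarz)
    moreover have "norm (gradient f (u + t *\<^sub>R w) - gradient f u) \<le> L * (t * norm w)"
      using assms t unfolding L_smooth_def by (metis add_diff_cancel_left' norm_scaleR abs_of_nonneg)
    then have "norm w * norm (gradient f (u + t *\<^sub>R w) - gradient f u) \<le> norm w * (L * (t * norm w))"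
      by (rule mult_left_mono) simp
    ultimately show "\<exists>y. (\<psi> has_real_derivative y) (at t) \<and> y \<le> 0"
      by (intro exI[of _ ?d]) (auto simp: inner_diff_right power2_eq_square algebra_simps)
  qed simp
  then show ?thesis by (simp add: \<psi>_def)
qed

lemma descent_step:
  assumes "L_smooth L f" "0 < L"
  shows "f (u - (1 / L) *\<^sub>R d) \<le> f u - inner d (gradient f u) / L + (norm d)\<^sup>2 / (2 * L)"
proof -
  have "(norm (- (1 / L) *\<^sub>R d))\<^sup>2 = (norm d)\<^sup>2 / L\<^sup>2"
    using assms(2) by (simp add: power_divide)
  then have "L / 2 * (norm (- (1 / L) *\<^sub>R d))\<^sup>2 = (norm d)\<^sup>2 / (2 * L)"
    using assms(2) by (simp add: power2_eq_square)
  then show ?thesis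
    using descent[OF assms(1), of u "- (1 / L) *\<^sub>R d"] by simp
qed

lemma convex_gradient_ineq:
  assumes "convex_on UNIV f"
  shows "f u + inner (v - u) (gradient f u) \<le> f v"
proof -
  let ?h = "\<lambda>t. f (u + t *\<^sub>R (v - u))"
  have "convex_on UNIV ?h"
  proof (rule convex_onI)
    fix t a b :: real assume t: "0 < t" "t < 1"
    have "u + ((1 - t) *\<^sub>R a + t *\<^sub>R b) *\<^sub>R (v - u)
        = (1 - t) *\<^sub>R (u + a *\<^sub>R (v - u)) + t *\<^sub>R (u + b *\<^sub>R (v - u))"
      by (simp add: algebra_simps)
    then show "?h ((1 - t) *\<^sub>R a + t *\<^sub>R b) \<le> (1 - t) * ?h a + t * ?h b"
      using convex_onD[OF assms, of t] t by (metis UNIV_I less_imp_le)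
  qed simp
  then have "inner (v - u) (gradient f (u + 0 *\<^sub>R (v - u))) * (1 - 0) \<le> ?h 1 - ?h 0"
    by (rule convex_on_imp_above_tangent[where A = UNIV])
      (auto intro!: DERIV_subset[OF DERIV_along_line] simp del: scaleR_zero_left)
  then show ?thesis by simp
qed

text \<open>At the point \<open>u - (\<nabla>f(u) - \<nabla>f(v)) / L\<close> the tangent at \<open>v\<close> bounds \<open>f\<close> from below and the descent
  estimate from \<open>u\<close> bounds it from above.\<close>

lemma smooth_convex_interpolation:
  assumes "convex_on UNIV f" "L_smooth L f" "0 < L"
  shows "f v + inner (u - v) (gradient f v) + (norm (gradient f u - gradient f v))\<^sup>2 / (2 * L) \<le> f u"
proof -
  let ?d = "gradient f u - gradient f v"
  let ?w = "u - (1 / L) *\<^sub>R ?d"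
  have "f v + inner (?w - v) (gradient f v) \<le> f ?w"
    by (rule convex_gradient_ineq[OF assms(1)])
  also have "\<dots> \<le> f u - inner ?d (gradient f u) / L + (norm ?d)\<^sup>2 / (2 * L)"
    by (rule descent_step[OF assms(2,3)])
  finally have "f v + inner (?w - v) (gradient f v)
      \<le> f u - inner ?d (gradient f u) / L + (norm ?d)\<^sup>2 / (2 * L)" .
  moreover have "inner (?w - v) (gradient f v) = inner (u - v) (gradient f v) - inner ?d (gradient f v) / L"
    by (simp add: inner_diff_left)
  moreover have "inner ?d (gradient f u) / L - inner ?d (gradient f v) / L = (norm ?d)\<^sup>2 / L"
    by (simp add: power2_norm_eq_inner inner_diff_right diff_divide_distrib)
  moreover have "(norm ?d)\<^sup>2 / L = 2 * ((norm ?d)\<^sup>2 / (2 * L))" by simp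
  ultimately show ?thesis by linarith
qed

lemma gradient_minimizer:
  assumes "L_smooth L f" "0 < L" "\<forall>u. f x \<le> f u"
  shows "gradient f x = 0"
proof -
  let ?G = "gradient f x"
  have "f x \<le> f (x - (1 / L) *\<^sub>R ?G)" using assms(3) by blast
  also have "\<dots> \<le> f x - inner ?G ?G / L + (norm ?G)\<^sup>2 / (2 * L)"
    by (rule descent_step[OF assms(1,2)])
  finally have "(norm ?G)\<^sup>2 / L \<le> (norm ?G)\<^sup>2 / (2 * L)"
    by (simp add: power2_norm_eq_inner)
  then have "(norm ?G)\<^sup>2 \<le> 0" using assms(2) by (simp add: field_simps)
  then show ?thesis by simp
qed

end

section \<open>Weighted sums of interpolation inequalities\<close>

lemma inner_le_half_squares:
  fixes a b :: "'a::real_inner"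
  shows "inner a b \<le> (norm a)\<^sup>2 / 2 + (norm b)\<^sup>2 / 2"
  using zero_le_power2[of "norm (a - b)"]
  by (simp add: power2_norm_eq_inner inner_diff inner_commute field_simps)

text \<open>The matrix with off-diagonal entries \<open>- m i t\<close> and vanishing row sums is the Laplacian of a
  graph with edge weights \<open>m i t \<ge> 0\<close>, so its quadratic form \<open>\<Sum>i<t. m i t * (norm (g i - g t))\<^sup>2\<close> is
  nonnegative. The two inner sums on the right collect the weights of the edges from \<open>t\<close> to
  earlier and to later vertices.\<close>

lemma cross_terms_le_squares:
  fixes m :: "nat \<Rightarrow> nat \<Rightarrow> real" and g :: "nat \<Rightarrow> 'a::real_inner"
  assumes "\<And>i t. i < t \<Longrightarrow> t \<le> n \<Longrightarrow> 0 \<le> m i t"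
  shows "2 * (\<Sum>t\<le>n. \<Sum>i<t. m i t * inner (g i) (g t))
    \<le> (\<Sum>t\<le>n. ((\<Sum>i<t. m i t) + (\<Sum>k=Suc t..n. m t k)) * (norm (g t))\<^sup>2)"
proof -
  have "2 * (\<Sum>t\<le>n. \<Sum>i<t. m i t * inner (g i) (g t))
      \<le> (\<Sum>t\<le>n. \<Sum>i<t. m i t * (norm (g t))\<^sup>2 + m i t * (norm (g i))\<^sup>2)"
    unfolding sum_distrib_left
  proof (intro sum_mono)
    fix t i assume "t \<in> {..n}" "i \<in> {..<t}"
    then have "0 \<le> m i t" using assms by auto
    moreover have "2 * inner (g i) (g t) \<le> (norm (g t))\<^sup>2 + (norm (g i))\<^sup>2"
      using inner_le_half_squares[of "g i" "g t"] by simp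
    ultimately have "m i t * (2 * inner (g i) (g t)) \<le> m i t * ((norm (g t))\<^sup>2 + (norm (g i))\<^sup>2)"
      by (rule mult_left_mono[rotated])
    then show "2 * (m i t * inner (g i) (g t)) \<le> m i t * (norm (g t))\<^sup>2 + m i t * (norm (g i))\<^sup>2"
      by (simp add: algebra_simps)
  qed
  also have "\<dots> = (\<Sum>t\<le>n. (\<Sum>i<t. m i t) * (norm (g t))\<^sup>2) + (\<Sum>t\<le>n. \<Sum>i<t. m i t * (norm (g i))\<^sup>2)"
    by (simp add: sum.distrib sum_distrib_right)
  also have "(\<Sum>t\<le>n. \<Sum>i<t. m i t * (norm (g i))\<^sup>2) = (\<Sum>i<n. \<Sum>k=Suc i..n. m i k * (norm (g i))\<^sup>2)"
    using sum.nested_swap[of "\<lambda>t i. m i t * (norm (g i))\<^sup>2" n]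
    by (simp add: atLeast0AtMost atLeast0LessThan)
  also have "\<dots> = (\<Sum>i\<le>n. (\<Sum>k=Suc i..n. m i k) * (norm (g i))\<^sup>2)"
    by (simp add: lessThan_Suc_atMost[symmetric] sum_distrib_right)
  finally show ?thesis
    by (simp add: sum.distrib distrib_right)
qed

lemma norm_sum_sq:
  fixes a :: "nat \<Rightarrow> 'a::real_inner"
  shows "(norm (\<Sum>t\<le>n. a t))\<^sup>2 = (\<Sum>t\<le>n. (norm (a t))\<^sup>2) + 2 * (\<Sum>t\<le>n. \<Sum>i<t. inner (a i) (a t))"
proof (induction n)
  case (Suc n)
  have "(norm (\<Sum>t\<le>Suc n. a t))\<^sup>2
      = (norm (\<Sum>t\<le>n. a t))\<^sup>2 + (norm (a (Suc n)))\<^sup>2 + 2 * inner (\<Sum>t\<le>n. a t) (a (Suc n))"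
    by (simp add: power2_norm_eq_inner inner_add inner_commute)
  then show ?case
    by (simp add: Suc.IH inner_sum_left lessThan_Suc_atMost)
qed simp

text \<open>The estimate behind the rate, for arbitrary points \<open>p t\<close> with gradients \<open>g t\<close> and values
  \<open>\<phi> t\<close>. The inequality \<open>star\<close> compares \<open>p t\<close> with the reference point \<open>u\<close>, and \<open>chain\<close> compares it
  with its predecessor, from which the gradient step leads to \<open>y (Suc t)\<close>. If they are added with
  weights \<open>c t\<close> and \<open>B (Suc t)\<close>, then the values telescope to \<open>B (Suc N) * \<phi> N\<close>. The terms
  that are linear in \<open>x0 - u\<close> are absorbed by \<open>(norm (x0 - u - (\<Sum>t\<le>N. c t *\<^sub>R g t)))\<^sup>2 \<ge> 0\<close>; by \<open>steps\<close> and
  \<open>balance\<close> the remaining quadratic form in the gradients is minus half the Laplacian form with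
  edge weights \<open>m\<close>.\<close>

lemma weighted_interpolation_bound:
  fixes g p y :: "nat \<Rightarrow> 'a::real_inner" and u x0 :: 'a
    and \<phi> c B :: "nat \<Rightarrow> real" and m :: "nat \<Rightarrow> nat \<Rightarrow> real"
  assumes B0: "B 0 = 0" and B_Suc: "\<And>t. B (Suc t) = B t + c t"
    and c_nonneg: "\<And>t. t \<le> N \<Longrightarrow> 0 \<le> c t" and m_nonneg: "\<And>i t. i < t \<Longrightarrow> t \<le> N \<Longrightarrow> 0 \<le> m i t"
    and star: "\<And>t. t \<le> N \<Longrightarrow> \<phi> t \<le> inner (g t) (p t - u) - (norm (g t))\<^sup>2 / 2"
    and chain: "\<And>t. t < N \<Longrightarrow> \<phi> (Suc t) \<le> \<phi> t - (norm (g t))\<^sup>2 / 2 - (norm (g (Suc t)))\<^sup>2 / 2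
        + inner (g (Suc t)) (p (Suc t) - y (Suc t))"
    and steps: "\<And>t. t \<le> N \<Longrightarrow> c t *\<^sub>R (x0 - p t) + B t *\<^sub>R (y t - p t)
        = (\<Sum>i<t. (c t * c i - m i t) *\<^sub>R g i)"
    and balance: "\<And>t. t \<le> N \<Longrightarrow> (c t)\<^sup>2 + (\<Sum>i<t. m i t) + (\<Sum>k=Suc t..N. m t k)
        = c t + B t + (if t < N then B (Suc t) else 0)"
  shows "B (Suc N) * \<phi> N \<le> (norm (x0 - u))\<^sup>2 / 2"
proof -
  define G where "G t = (norm (g t))\<^sup>2" for t
  (* The cross terms of index t: the part of the star and chain inequalities in which g t meets
     the displacements, which are combinations of the earlier gradients. *)
  define X where "X t = inner (g t) (\<Sum>i<t. (c t * c i - m i t) *\<^sub>R g i)" for t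
  have B_nonneg: "0 \<le> B t" if "t \<le> Suc N" for t
    using that by (induction t) (auto simp: B0 B_Suc c_nonneg)
  (* The last chain inequality leads into n, so the square of g t enters the sum up to n through
     the link that leaves t only when t < n. *)
  define E where "E n = (\<Sum>t\<le>n. c t * inner (g t) (x0 - u) - X t
      - (c t + B t + (if t < n then B (Suc t) else 0)) * G t / 2)" for n
  have telescope: "B (Suc n) * \<phi> n \<le> E n" if "n \<le> N" for n
    using that
  proof (induction n)
    case 0
    have "c 0 * \<phi> 0 \<le> c 0 * (inner (g 0) (p 0 - u) - G 0 / 2)"
      unfolding G_def by (intro mult_left_mono star c_nonneg) auto
    moreover have "c 0 * inner (g 0) (x0 - p 0) = 0"
      using arg_cong[OF steps[of 0], of "inner (g 0)"] B0 by (simp del: inner_diff_right)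
    then have "c 0 * inner (g 0) (x0 - u) = c 0 * inner (g 0) (p 0 - u)"
      unfolding inner_diff_right by argo
    ultimately have "c 0 * \<phi> 0 \<le> c 0 * inner (g 0) (x0 - u) - c 0 * G 0 / 2"
      by (simp only: right_diff_distrib times_divide_eq_right)
    then show ?case
      by (simp add: B_Suc B0 X_def E_def)
  next
    case (Suc n)
    let ?t = "Suc n"
    have step: "c ?t * \<phi> ?t \<le> c ?t * (inner (g ?t) (p ?t - u) - G ?t / 2)"
      unfolding G_def using Suc.prems by (intro mult_left_mono star c_nonneg) auto
    have link: "B ?t * \<phi> ?t \<le> B ?t * (\<phi> n - G n / 2 - G ?t / 2 + inner (g ?t) (p ?t - y ?t))"
      unfolding G_def using Suc.prems by (intro mult_left_mono chain B_nonneg) auto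
    have X: "X ?t = c ?t * inner (g ?t) (x0 - u) - c ?t * inner (g ?t) (p ?t - u)
        - B ?t * inner (g ?t) (p ?t - y ?t)"
      unfolding X_def steps[OF Suc.prems, symmetric]
      by (simp add: inner_add inner_diff algebra_simps)
    have E: "E ?t = E n - B ?t * G n / 2 + c ?t * inner (g ?t) (x0 - u) - X ?t - (c ?t + B ?t) * G ?t / 2"
      unfolding E_def lessThan_Suc_atMost[symmetric] sum.lessThan_Suc
      by (simp add: distrib_right add_divide_distrib)
    have "B (Suc ?t) * \<phi> ?t = B ?t * \<phi> ?t + c ?t * \<phi> ?t"
      by (simp add: B_Suc[of ?t] distrib_right)
    also have "\<dots> \<le> E ?t"
      using Suc step link unfolding E X
      by (simp add: distrib_left distrib_right right_diff_distrib add_divide_distrib del: inner_diff_right)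
    finally show ?case .
  qed
  have X_split: "X t = (\<Sum>i<t. inner (c i *\<^sub>R g i) (c t *\<^sub>R g t)) - (\<Sum>i<t. m i t * inner (g i) (g t))" for t
    unfolding X_def inner_sum_right sum_subtractf[symmetric]
    by (intro sum.cong) (auto simp: inner_commute algebra_simps)
  let ?W = "\<Sum>t\<le>N. c t *\<^sub>R g t"
  have square: "inner ?W (x0 - u) \<le> (norm ?W)\<^sup>2 / 2 + (norm (x0 - u))\<^sup>2 / 2"
    by (rule inner_le_half_squares)
  have "B (Suc N) * \<phi> N \<le> (\<Sum>t\<le>N. c t * inner (g t) (x0 - u) - X t
      - (c t + B t + (if t < N then B (Suc t) else 0)) * G t / 2)"
    using telescope[of N] by (simp add: E_def)
  also have "\<dots> = inner ?W (x0 - u) - (\<Sum>t\<le>N. X t)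
      - (\<Sum>t\<le>N. ((c t)\<^sup>2 + (\<Sum>i<t. m i t) + (\<Sum>k=Suc t..N. m t k)) * G t) / 2"
    by (simp add: sum_subtractf inner_sum_left sum_divide_distrib balance)
  also have "\<dots> = inner ?W (x0 - u) - (norm ?W)\<^sup>2 / 2
      + (\<Sum>t\<le>N. \<Sum>i<t. m i t * inner (g i) (g t))
      - (\<Sum>t\<le>N. ((\<Sum>i<t. m i t) + (\<Sum>k=Suc t..N. m t k)) * G t) / 2"
    unfolding norm_sum_sq X_split
    by (simp add: sum_subtractf G_def distrib_right sum.distrib power_mult_distrib add_divide_distrib)
  also have "\<dots> \<le> (norm (x0 - u))\<^sup>2 / 2"
    using square cross_terms_le_squares[where m=m and g=g and n=N, OF m_nonneg] unfolding G_def by simp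
  finally show ?thesis .
qed

section \<open>The step size sequence\<close>

lemma theta_ge_1: "1 \<le> theta k"
proof (induction k)
  case (Suc k)
  have "1 \<le> sqrt (1 + 4 * (theta k)\<^sup>2)" by simp
  then show ?case by simp
qed simp

lemma theta_Suc_sq: "(theta (Suc k))\<^sup>2 = theta (Suc k) + (theta k)\<^sup>2"
proof -
  have "(sqrt (1 + 4 * (theta k)\<^sup>2))\<^sup>2 = 1 + 4 * (theta k)\<^sup>2" by simp
  then show ?thesis by (simp add: power2_eq_square field_simps)
qed

lemma theta_step: "theta k + 1 / 2 \<le> theta (Suc k)"
proof -
  have "2 * theta k \<le> sqrt (1 + 4 * (theta k)\<^sup>2)"
    by (rule real_le_rsqrt) (simp add: power_mult_distrib)
  then show ?thesis by simp
qed

lemma theta_mono: "j \<le> k \<Longrightarrow> theta j \<le> theta k"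
proof (rule lift_Suc_mono_le)
  show "theta n \<le> theta (Suc n)" for n
    using theta_step[of n] by linarith
qed

definition theta_sum :: "nat \<Rightarrow> real" where "theta_sum k = (\<Sum>i<k. theta i)"
definition theta_sq_sum :: "nat \<Rightarrow> real" where "theta_sq_sum k = (\<Sum>i<k. (theta i)\<^sup>2)"
definition theta_mean :: "nat \<Rightarrow> real" where "theta_mean k = theta_sq_sum k / theta_sum k"

lemma theta_sum_0 [simp]: "theta_sum 0 = 0" by (simp add: theta_sum_def)
lemma theta_sum_Suc: "theta_sum (Suc k) = theta_sum k + theta k" by (simp add: theta_sum_def)
lemma theta_sq_sum_0 [simp]: "theta_sq_sum 0 = 0" by (simp add: theta_sq_sum_def)
lemma theta_sq_sum_Suc: "theta_sq_sum (Suc k) = theta_sq_sum k + (theta k)\<^sup>2"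
  by (simp add: theta_sq_sum_def)

text \<open>The recursion of \<open>theta\<close> is the quadratic equation \<open>\<theta>\<^sub>k\<^sub>+\<^sub>1\<^sup>2 - \<theta>\<^sub>k\<^sub>+\<^sub>1 = \<theta>\<^sub>k\<^sup>2\<close>, so the squares have the \<open>\<theta>\<^sub>k\<close>
  themselves as increments.\<close>

lemma theta_sum_Suc_eq: "theta_sum (Suc k) = (theta k)\<^sup>2"
proof (induction k)
  case (Suc k)
  then show ?case by (simp only: theta_sum_Suc[of "Suc k"] theta_Suc_sq)
qed (simp add: theta_sum_def)

lemma theta_sum_eq: "theta_sum k = (theta k)\<^sup>2 - theta k"
  using theta_sum_Suc_eq[of k] by (simp add: theta_sum_Suc)

lemma theta_sum_ge_1: "1 \<le> k \<Longrightarrow> 1 \<le> theta_sum k"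
  using theta_ge_1 one_le_power by (cases k) (auto simp: theta_sum_Suc_eq)

lemma theta_sum_nonneg: "0 \<le> theta_sum k"
  using theta_sum_ge_1[of k] by (cases "k = 0") auto

lemma theta_sum_mono: "j \<le> k \<Longrightarrow> theta_sum j \<le> theta_sum k"
proof (rule lift_Suc_mono_le)
  show "theta_sum n \<le> theta_sum (Suc n)" for n
    using theta_ge_1[of n] by (simp add: theta_sum_Suc)
qed

lemma theta_sq_sum_nonneg: "0 \<le> theta_sq_sum k"
  unfolding theta_sq_sum_def by (intro sum_nonneg) simp

lemma theta_mean_nonneg: "0 \<le> theta_mean k"
  unfolding theta_mean_def by (intro divide_nonneg_nonneg theta_sq_sum_nonneg theta_sum_nonneg)

lemma theta_mean_0 [simp]: "theta_mean 0 = 0" by (simp add: theta_mean_def)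

text \<open>With \<open>r = theta_mean k\<close> and \<open>\<theta> = theta k\<close> the new mean is \<open>(r (\<theta>\<^sup>2 - \<theta>) + \<theta>\<^sup>2) / \<theta>\<^sup>2\<close>. The
  formula covers \<open>k = 0\<close> because the empty mean is \<open>0 / 0 = 0\<close>.\<close>

lemma theta_mean_Suc: "theta_mean (Suc k) = theta_mean k + 1 - theta_mean k / theta k"
proof -
  have t: "theta k \<noteq> 0" using theta_ge_1[of k] by auto
  have "theta_sq_sum k = theta_mean k * theta_sum k"
    using theta_sum_ge_1[of k] by (cases "k = 0") (auto simp: theta_mean_def)
  then have "theta_mean (Suc k) = (theta_mean k * ((theta k)\<^sup>2 - theta k) + (theta k)\<^sup>2) / (theta k)\<^sup>2"
    by (simp add: theta_mean_def[of "Suc k"] theta_sq_sum_Suc theta_sum_Suc_eq theta_sum_eq[of k])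
  also have "\<dots> = theta_mean k + 1 - theta_mean k / theta k"
    using t by (simp add: field_simps power2_eq_square)
  finally show ?thesis .
qed

text \<open>The sequence \<open>\<theta>\<^sub>k\<close> grows like \<open>k / 2\<close>, so its mean with weights \<open>\<theta>\<^sub>i\<close> is about
  two thirds of the last term. In the recursion the new mean increases with the old one, and where
  the bound holds with equality, a step raises three times the mean by \<open>1\<close> and twice \<open>theta\<close> by
  at least \<open>1\<close>.\<close>

lemma theta_mean_le: "3 * theta_mean k \<le> 2 * theta k"
  and theta_mean_Suc_le: "3 * theta_mean (Suc k) \<le> 2 * theta k + 1"
proof -
  have step: "3 * theta_mean (Suc k) \<le> 2 * theta k + 1" if "3 * theta_mean k \<le> 2 * theta k" for k
  proof -
    have t: "0 < theta k" "0 \<le> 1 - 1 / theta k" using theta_ge_1[of k] by auto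
    have "3 * theta_mean (Suc k) = 3 * theta_mean k * (1 - 1 / theta k) + 3"
      by (simp add: theta_mean_Suc algebra_simps)
    also have "\<dots> \<le> 2 * theta k * (1 - 1 / theta k) + 3"
      using that t by (intro add_right_mono mult_right_mono) auto
    also have "\<dots> = 2 * theta k + 1" using t by (simp add: field_simps)
    finally show ?thesis .
  qed
  show "3 * theta_mean k \<le> 2 * theta k"
  proof (induction k)
    case (Suc k)
    then show ?case using step[OF Suc] theta_step[of k] by linarith
  qed simp
  then show "3 * theta_mean (Suc k) \<le> 2 * theta k + 1" by (rule step)
qed

lemma theta_mean_mono: "j \<le> k \<Longrightarrow> theta_mean j \<le> theta_mean k"
proof (rule lift_Suc_mono_le)
  show "theta_mean n \<le> theta_mean (Suc n)" for n
    using theta_mean_le[of n] theta_ge_1[of n] by (simp add: theta_mean_Suc)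
qed

lemma cross_sum: "(\<Sum>i<k. theta i * theta_sum i) = ((theta_sum k)\<^sup>2 - theta_sq_sum k) / 2"
  by (induction k) (simp_all add: theta_sum_Suc theta_sq_sum_Suc power2_eq_square field_simps)

lemma cube_sum: "2 * (\<Sum>i<k. theta i ^ 3) = (theta_sum k)\<^sup>2 + theta_sq_sum k"
proof -
  have "theta i ^ 3 = theta i * theta_sum i + (theta i)\<^sup>2" for i
    by (simp add: theta_sum_eq power2_eq_square power3_eq_cube algebra_simps)
  then have "(\<Sum>i<k. theta i ^ 3) = (\<Sum>i<k. theta i * theta_sum i) + theta_sq_sum k"
    by (simp add: sum.distrib theta_sq_sum_def)
  then show ?thesis by (simp add: cross_sum field_simps)
qed

section \<open>The weights\<close>

text \<open>If all scaled gradients equal one unit vector, then \<open>y k\<close> has moved from the starting point by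
  \<open>(theta_sum k + theta_mean k) / 2\<close>. The total weight is \<open>1\<close> plus twice this distance for
  \<open>k = N\<close>. This is the ratio of \<open>norm (x 0 - x_star)\<close> to the norm of the constant scaled
  gradient for the Huber function that attains the rate.\<close>

definition total_weight :: "nat \<Rightarrow> real" where "total_weight N = theta_sum N + theta_mean N + 1"

text \<open>The weight \<open>theta_sum k * chain_ratio N k\<close> of the inequality between the points \<open>k - 1\<close> and \<open>k\<close> is
  forced: the quadratic form in the gradients has to vanish when all gradients agree, which gives
  one linear recursion step for each \<open>k\<close>, and this recursion telescopes. The denominator
  is twice the total weight minus twice the distance travelled by \<open>y k\<close>; the numerator is
  \<open>2 * theta_sum N\<close> times the mean of \<open>1 - theta_sum i / theta_sum N\<close> with weights \<open>theta i\<close>,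
  \<open>i < k\<close>.\<close>

definition chain_ratio :: "nat \<Rightarrow> nat \<Rightarrow> real" where
  "chain_ratio N k = total_weight N / theta_sum N * ((2 * theta_sum N - theta_sum k + theta_mean k)
     / (2 * total_weight N - theta_sum k - theta_mean k))"

lemma total_weight_ge_1: "1 \<le> total_weight N"
  using theta_sum_nonneg[of N] theta_mean_nonneg[of N] by (simp add: total_weight_def)

lemma chain_ratio_denom_pos:
  assumes "k \<le> N" shows "0 < 2 * total_weight N - theta_sum k - theta_mean k"
  using theta_sum_mono[OF assms] theta_mean_mono[OF assms] theta_sum_nonneg[of N] theta_mean_nonneg[of N]
  unfolding total_weight_def by argo

text \<open>This is the inequality \<open>chain_ratio N k \<le> chain_ratio N (Suc k)\<close> with denominators cleared, for
  \<open>t = theta k\<close>, \<open>u = theta (N - 1)\<close>, \<open>r = theta_mean k\<close> and \<open>R = theta_mean N\<close>. The difference of the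
  two sides decreases in \<open>r\<close>, hence is smallest for \<open>r = 2 * t / 3\<close>, and there the bound on \<open>R\<close>
  leaves \<open>(u - t)\<^sup>2 + 3 * (u - t) + (u - 1) * (u - 4 / 3)\<close> up to a positive factor. The values of
  \<open>theta\<close> avoid the gap between \<open>1\<close> and \<open>4 / 3\<close>.\<close>

lemma ratio_growth_aux:
  fixes t u r R :: real
  assumes t: "1 \<le> t" "t \<le> u" and u: "u = 1 \<or> 4 / 3 \<le> u"
    and r: "0 \<le> r" "3 * r \<le> 2 * t" and R: "0 \<le> R" "3 * R \<le> 2 * u + 1"
  shows "t\<^sup>2 * (R + 1 - r) \<le> (t - r) * (2 * u\<^sup>2 - (t\<^sup>2 - t) + R + 1)"
proof -
  have "0 \<le> (u - t)\<^sup>2 + 3 * (u - t) + (u - 1) * (u - 4 / 3)"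
    using u t by (intro add_nonneg_nonneg) (auto intro: mult_nonneg_nonneg)
  also have "\<dots> = 2 * u\<^sup>2 + t\<^sup>2 + t - (2 / 3) * (u + 2) * (3 * t - 1)"
    by (simp add: power2_eq_square field_simps)
  finally have "0 \<le> 2 * u\<^sup>2 + t\<^sup>2 + t - (2 / 3) * (u + 2) * (3 * t - 1)" .
  moreover have "(R + 1) * (3 * t - 1) \<le> (2 / 3) * (u + 2) * (3 * t - 1)"
    using R t by (intro mult_right_mono) auto
  ultimately have "0 \<le> 2 * u\<^sup>2 + t\<^sup>2 + t - (R + 1) * (3 * t - 1)" by linarith
  then have "0 \<le> t / 3 * (2 * u\<^sup>2 + t\<^sup>2 + t - (R + 1) * (3 * t - 1))"
    using t by (intro mult_nonneg_nonneg) auto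
  moreover have "t\<^sup>2 \<le> u\<^sup>2" using t by (intro power_mono) auto
  then have "0 \<le> 2 * u\<^sup>2 - (2 * t\<^sup>2 - t) + R + 1" using t R by linarith
  then have "0 \<le> (2 * t / 3 - r) * (2 * u\<^sup>2 - (2 * t\<^sup>2 - t) + R + 1)"
    using r by (intro mult_nonneg_nonneg) auto
  moreover have "(t - r) * (2 * u\<^sup>2 - (t\<^sup>2 - t) + R + 1) - t\<^sup>2 * (R + 1 - r)
      = t / 3 * (2 * u\<^sup>2 + t\<^sup>2 + t - (R + 1) * (3 * t - 1))
        + (2 * t / 3 - r) * (2 * u\<^sup>2 - (2 * t\<^sup>2 - t) + R + 1)"
    by (simp add: power2_eq_square field_simps)
  ultimately show ?thesis by linarith
qed

text \<open>Let \<open>r = theta_mean k\<close>, \<open>R = theta_mean N\<close>, and let \<open>D\<close> be the denominator for \<open>k\<close>. Up to a factor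
  independent of \<open>k\<close> the ratio is \<open>1 - 2 * (R + 1 - r) / D\<close>. Passing from \<open>k\<close> to \<open>Suc k\<close> raises \<open>r\<close>
  by \<open>d = 1 - r / theta k\<close> and lowers \<open>D\<close> by \<open>theta k + d\<close>; the first effect wins.\<close>

lemma chain_ratio_mono:
  assumes "k < N"
  shows "chain_ratio N k \<le> chain_ratio N (Suc k)"
proof -
  obtain M where M: "N = Suc M" using assms by (cases N) auto
  define t u r R where "t = theta k" and "u = theta M" and "r = theta_mean k" and "R = theta_mean N"
  define D where "D = 2 * u\<^sup>2 + 2 * R + 2 - (t\<^sup>2 - t) - r"
  define d where "d = 1 - r / t"
  have s: "theta_sum k = t\<^sup>2 - t" "theta_sum (Suc k) = t\<^sup>2" "theta_sum N = u\<^sup>2"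
    by (simp_all add: theta_sum_eq[of k] theta_sum_Suc_eq M t_def u_def)
  have r': "theta_mean (Suc k) = r + d"
    by (simp add: theta_mean_Suc r_def d_def t_def)
  have t: "1 \<le> t" "t \<le> u" using assms M by (auto simp: t_def u_def theta_ge_1 theta_mono)
  have u1: "u = 1 \<or> 4 / 3 \<le> u"
  proof (cases M)
    case (Suc m)
    then show ?thesis using theta_step[of m] theta_ge_1[of m] unfolding u_def by simp
  qed (simp add: u_def)
  have "t\<^sup>2 * (R + 1 - r) \<le> (t - r) * (2 * u\<^sup>2 - (t\<^sup>2 - t) + R + 1)"
    using theta_mean_le[of k] theta_mean_Suc_le[of M]
    by (intro ratio_growth_aux t u1) (auto simp: r_def t_def R_def M u_def theta_mean_nonneg)
  then have "t * (t * (R + 1 - r)) \<le> t * (d * (2 * u\<^sup>2 - (t\<^sup>2 - t) + R + 1))"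
    using t by (simp add: d_def power2_eq_square right_diff_distrib mult.assoc[symmetric])
  then have "t * (R + 1 - r) \<le> d * (2 * u\<^sup>2 - (t\<^sup>2 - t) + R + 1)"
    using t by (simp only: mult_le_cancel_left_pos)
  also have "2 * u\<^sup>2 - (t\<^sup>2 - t) + R + 1 = D - (R + 1 - r)" by (simp add: D_def)
  finally have key: "t * (R + 1 - r) \<le> d * (D - (R + 1 - r))" .
  have D: "0 < D" "0 < D - t - d"
    using chain_ratio_denom_pos[of k N] chain_ratio_denom_pos[of "Suc k" N] assms
    unfolding total_weight_def s r' unfolding D_def r_def R_def by (auto simp: algebra_simps)
  have "(D - 2 * (R + 1 - r)) * (D - t - d) \<le> (D - t - d - 2 * (R + 1 - r - d)) * D"
    using key by (simp add: algebra_simps)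
  then have "(D - 2 * (R + 1 - r)) / D \<le> (D - t - d - 2 * (R + 1 - r - d)) / (D - t - d)"
    using D by (simp add: divide_simps mult.commute)
  moreover have "2 * theta_sum N - theta_sum k + theta_mean k = D - 2 * (R + 1 - r)"
    "2 * total_weight N - theta_sum k - theta_mean k = D"
    "2 * theta_sum N - theta_sum (Suc k) + theta_mean (Suc k) = D - t - d - 2 * (R + 1 - r - d)"
    "2 * total_weight N - theta_sum (Suc k) - theta_mean (Suc k) = D - t - d"
    unfolding total_weight_def s r' unfolding D_def r_def R_def by (simp_all add: algebra_simps)
  ultimately show ?thesis
    unfolding chain_ratio_def using total_weight_ge_1[of N] theta_sum_nonneg[of N]
    by (intro mult_left_mono) auto
qed

text \<open>The weight of the inequality between the points \<open>k - 1\<close> and \<open>k\<close>. The value at \<open>Suc N\<close> closes the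
  telescoping sum and becomes the coefficient of the final function value.\<close>

definition chain_weight :: "nat \<Rightarrow> nat \<Rightarrow> real" where
  "chain_weight N k = (if k \<le> N then theta_sum k * chain_ratio N k else total_weight N)"

definition star_weight :: "nat \<Rightarrow> nat \<Rightarrow> real" where
  "star_weight N t = chain_weight N (Suc t) - chain_weight N t"

text \<open>The minimum makes the index \<open>Suc N\<close> meaningful: the last point \<open>y N\<close> is a plain gradient step
  without momentum, so the positions \<open>N\<close> and \<open>Suc N\<close> share the normalisation \<open>theta_sum N\<close>.\<close>

definition chain_slope :: "nat \<Rightarrow> nat \<Rightarrow> real" where
  "chain_slope N k = chain_weight N k / theta_sum (min k N)"

text \<open>Half of this number is the coefficient of \<open>(norm (g i - g t))\<^sup>2\<close> in the final sum of squares. It is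
  read off from the coefficient of \<open>inner (g i) (g t)\<close>, after the displacement of the points has been
  written in terms of the gradients; see \<open>FGM_displacement\<close>.\<close>

definition pair_weight :: "nat \<Rightarrow> nat \<Rightarrow> nat \<Rightarrow> real" where
  "pair_weight N i t = star_weight N t * (star_weight N i - theta i)
     + theta i * theta_sum i * (chain_slope N (Suc t) - chain_slope N t)"

lemma chain_weight_eq:
  assumes "k \<le> N" "1 \<le> N"
  shows "chain_weight N k * (2 * total_weight N - theta_sum k - theta_mean k)
    = theta_sum k * (2 * total_weight N - total_weight N / theta_sum N * (theta_sum k - theta_mean k))"
proof -
  let ?D = "2 * total_weight N - theta_sum k - theta_mean k"
  let ?n = "2 * theta_sum N - theta_sum k + theta_mean k"
  have "?D \<noteq> 0" using chain_ratio_denom_pos[OF assms(1)] by simp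
  then have "chain_weight N k * ?D = theta_sum k * (total_weight N / theta_sum N * ?n)"
    using assms(1) by (simp add: chain_weight_def chain_ratio_def)
  also have "total_weight N / theta_sum N * ?n
      = 2 * total_weight N - total_weight N / theta_sum N * (theta_sum k - theta_mean k)"
    using theta_sum_ge_1[OF assms(2)] by (simp add: field_simps)
  finally show ?thesis .
qed

lemma chain_weight_last:
  assumes "1 \<le> N"
  shows "chain_weight N N = total_weight N * (total_weight N - 1) / (total_weight N + 1)"
proof -
  have T: "theta_sum N \<noteq> 0" using theta_sum_ge_1[OF assms] by auto
  have "chain_weight N N = total_weight N * (theta_sum N + theta_mean N)
      / (2 * total_weight N - theta_sum N - theta_mean N)"
    using T by (simp add: chain_weight_def chain_ratio_def)
  then show ?thesis by (simp add: total_weight_def algebra_simps)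
qed

lemma star_weight_last:
  assumes "1 \<le> N"
  shows "star_weight N N * (total_weight N + 1) = 2 * total_weight N"
  using total_weight_ge_1[of N]
  by (simp add: star_weight_def chain_weight_last[OF assms] chain_weight_def[of N "Suc N"] field_simps)

lemma star_weight_last_pos:
  assumes "1 \<le> N" shows "0 < star_weight N N"
proof -
  have "star_weight N N = 2 * total_weight N / (total_weight N + 1)"
    using star_weight_last[OF assms] total_weight_ge_1[of N] by (simp add: field_simps)
  then show ?thesis using total_weight_ge_1[of N] by simp
qed

lemma chain_slope_eq: "1 \<le> k \<Longrightarrow> k \<le> N \<Longrightarrow> chain_slope N k = chain_ratio N k"
  using theta_sum_ge_1[of k] by (simp add: chain_slope_def chain_weight_def)

text \<open>The last step, into \<open>Suc N\<close>, leaves the normalisation unchanged and only adds the weight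
  \<open>star_weight N N\<close>.\<close>

lemma chain_slope_mono:
  assumes "1 \<le> t" "t \<le> N"
  shows "chain_slope N t \<le> chain_slope N (Suc t)"
proof (cases "t = N")
  case False
  then show ?thesis
    using assms chain_ratio_mono[of t N] by (simp add: chain_slope_eq)
next
  case True
  then show ?thesis
    using star_weight_last_pos[of N] assms theta_sum_nonneg[of N]
    by (simp add: chain_slope_def star_weight_def divide_right_mono)
qed

lemma chain_slope_ge_1:
  assumes "1 \<le> k" "k \<le> N" shows "1 \<le> chain_slope N k"
  using assms
proof (induction k rule: dec_induct)
  case base
  have T: "0 < theta_sum N" "0 \<le> theta_mean N"
    using base theta_sum_ge_1[of N] by (auto intro: theta_mean_nonneg)
  have "theta_sum 1 = 1" "theta_mean 1 = 1"
    by (simp_all add: theta_mean_def theta_sum_def theta_sq_sum_def)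
  then have "chain_ratio N 1 = total_weight N / theta_sum N * (2 * theta_sum N / (2 * (total_weight N - 1)))"
    by (simp add: chain_ratio_def)
  also have "\<dots> = total_weight N / (total_weight N - 1)"
    using T by (simp only: mult_divide_mult_cancel_left) simp
  also have "1 \<le> \<dots>" using T by (simp add: total_weight_def)
  finally have "1 \<le> chain_ratio N 1" .
  then show ?case
    using base by (simp add: chain_slope_eq)
next
  case (step n)
  then show ?case using chain_slope_mono[of n N] by simp
qed

text \<open>The chain weight is \<open>chain_slope\<close> times \<open>theta_sum\<close>, and the slope is nondecreasing and at least
  \<open>1\<close>; so its increment is at least that of \<open>theta_sum\<close>, which is \<open>theta t\<close>.\<close>

lemma star_weight_ge_theta:
  assumes "t < N" shows "theta t \<le> star_weight N t"
proof (cases "t = 0")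
  case True
  have "1 \<le> chain_ratio N 1"
    using chain_slope_ge_1[of 1 N] chain_slope_eq[of 1 N] assms by simp
  then show ?thesis
    using True assms by (simp add: star_weight_def chain_weight_def theta_sum_Suc)
next
  case False
  have "1 \<le> chain_ratio N t"
    using False assms chain_slope_ge_1[of t N] chain_slope_eq[of t N] by simp
  then have "theta t * 1 \<le> theta t * chain_ratio N t"
    using theta_ge_1[of t] by (intro mult_left_mono) auto
  also have "\<dots> = theta_sum (Suc t) * chain_ratio N t - theta_sum t * chain_ratio N t"
    by (simp add: theta_sum_Suc algebra_simps)
  also have "\<dots> \<le> theta_sum (Suc t) * chain_ratio N (Suc t) - theta_sum t * chain_ratio N t"
    using assms by (intro diff_right_mono mult_left_mono chain_ratio_mono theta_sum_nonneg)
  finally show ?thesis using assms by (simp add: star_weight_def chain_weight_def)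
qed

lemma star_weight_nonneg: "1 \<le> N \<Longrightarrow> t \<le> N \<Longrightarrow> 0 \<le> star_weight N t"
  using star_weight_last_pos[of N] star_weight_ge_theta[of t N] theta_ge_1[of t]
  by (cases "t = N") auto

lemma pair_weight_nonneg:
  assumes "i < t" "t \<le> N" shows "0 \<le> pair_weight N i t"
  unfolding pair_weight_def
  using assms star_weight_nonneg[of N t] star_weight_ge_theta[of i N] chain_slope_mono[of t N]
    theta_ge_1[of i] theta_sum_nonneg[of i]
  by (intro add_nonneg_nonneg mult_nonneg_nonneg) auto

lemma pair_weight_row_sum:
  "(\<Sum>i<t. pair_weight N i t) = star_weight N t * (chain_weight N t - theta_sum t)
    + theta_sum t * (theta_sum t - theta_mean t) / 2 * (chain_slope N (Suc t) - chain_slope N t)"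
proof -
  have "(\<Sum>i<t. star_weight N i) = chain_weight N t"
    unfolding star_weight_def by (subst sum_lessThan_telescope) (simp add: chain_weight_def)
  moreover have "theta_sq_sum t = theta_sum t * theta_mean t"
    using theta_sum_ge_1[of t] by (cases "t = 0") (auto simp: theta_mean_def)
  then have "(\<Sum>i<t. theta i * theta_sum i) = theta_sum t * (theta_sum t - theta_mean t) / 2"
    by (simp add: cross_sum power2_eq_square algebra_simps)
  ultimately show ?thesis
    unfolding pair_weight_def
    by (simp add: sum.distrib sum_distrib_left[symmetric] sum_distrib_right[symmetric] sum_subtractf
        theta_sum_def)
qed

lemma pair_weight_column_sum:
  assumes "t < N"
  shows "(\<Sum>k=Suc t..N. pair_weight N t k)
    = (total_weight N - chain_weight N (Suc t)) * (star_weight N t - theta t)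
      + theta t * theta_sum t * (total_weight N / theta_sum N - chain_slope N (Suc t))"
proof -
  have tele: "(\<Sum>k=Suc t..N. h (Suc k) - h k) = h (Suc N) - h (Suc t)" for h :: "nat \<Rightarrow> real"
    using sum_Suc_diff'[of "Suc t" "Suc N" h] assms
    by (simp add: atLeastLessThanSuc_atLeastAtMost)
  show ?thesis
    unfolding pair_weight_def
    by (simp add: sum.distrib sum_distrib_left[symmetric] sum_distrib_right[symmetric]
        star_weight_def[of _ "_ :: nat"] tele chain_weight_def[of N "Suc N"] chain_slope_def[of N "Suc N"])
qed

text \<open>The diagonal of the quadratic form. For \<open>t < N\<close> the two sides differ by half the difference of the
  equations \<open>chain_weight_eq\<close> for \<open>Suc t\<close> and \<open>t\<close>; for \<open>t = N\<close> the statement reduces to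
  \<open>star_weight_last\<close>.\<close>

lemma pair_weight_balance:
  assumes N: "1 \<le> N" and t: "t \<le> N"
  shows "(star_weight N t)\<^sup>2 + (\<Sum>i<t. pair_weight N i t) + (\<Sum>k=Suc t..N. pair_weight N t k)
    = star_weight N t + chain_weight N t + (if t < N then chain_weight N (Suc t) else 0)"
proof (cases "t = N")
  case True
  define A T R b c where "A = total_weight N" and "T = theta_sum N" and "R = theta_mean N"
    and "b = chain_weight N N" and "c = star_weight N N"
  have T: "T \<noteq> 0" using theta_sum_ge_1[OF N] by (auto simp: T_def)
  have A: "A = T + R + 1" by (simp add: A_def T_def R_def total_weight_def)
  have c: "c = A - b" "c * (A + 1) = 2 * A"
    using star_weight_last[OF N] by (simp_all add: A_def b_def c_def star_weight_def chain_weight_def)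
  have "chain_slope N (Suc N) - chain_slope N N = c / T"
    by (simp add: chain_slope_def c_def star_weight_def T_def diff_divide_distrib)
  then have "(\<Sum>i<N. pair_weight N i N) = c * (b - T) + T * (T - R) / 2 * (c / T)"
    unfolding pair_weight_row_sum by (simp add: b_def c_def T_def R_def)
  also have "\<dots> = c * (b - T) + (T - R) / 2 * c" using T by simp
  finally have "c\<^sup>2 + (\<Sum>i<N. pair_weight N i N) = c * ((c + b) - (T + R) / 2)"
    by (simp add: power2_eq_square field_simps)
  also have "\<dots> = c * (A + 1) / 2" using c(1) by (simp add: A field_simps)
  also have "\<dots> = c + b" using c by simp
  finally have "c\<^sup>2 + (\<Sum>i<N. pair_weight N i N) = c + b" .
  then show ?thesis using True by (simp add: b_def c_def)
next
  case False
  then have tN: "t < N" using t by simp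
  (* Writing the mean as q * h keeps every expression polynomial, because the next mean is
     q * h + 1 - q. *)
  define A w h q where "A = total_weight N" and "w = total_weight N / theta_sum N"
    and "h = theta t" and "q = theta_mean t / theta t"
  define b B s where "b = chain_weight N t" and "B = chain_weight N (Suc t)" and "s = h\<^sup>2 - h"
  have h: "1 \<le> h" using theta_ge_1 by (simp add: h_def)
  have s: "theta_sum t = s" "theta_sum (Suc t) = h\<^sup>2"
    by (simp_all add: s_def h_def theta_sum_eq[of t] theta_sum_Suc_eq)
  have r: "theta_mean t = q * h" "theta_mean (Suc t) = q * h + 1 - q"
    using h by (simp_all add: q_def h_def theta_mean_Suc)
  have eqs: "b * (2 * A - s - q * h) = s * (2 * A - w * (s - q * h))"
    "B * (2 * A - h\<^sup>2 - (q * h + 1 - q)) = h\<^sup>2 * (2 * A - w * (h\<^sup>2 - (q * h + 1 - q)))"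
    using chain_weight_eq[of t N] chain_weight_eq[of "Suc t" N] tN N
    by (simp_all add: s r A_def w_def b_def B_def)
  have slope: "s * chain_slope N t = b"
    using theta_sum_ge_1[of t] tN
    by (cases "t = 0") (auto simp: chain_slope_def b_def s[symmetric] chain_weight_def)
  have slope': "chain_slope N (Suc t) = B / h\<^sup>2"
    using tN by (simp add: chain_slope_def B_def s)
  have "(\<Sum>i<t. pair_weight N i t)
      = (B - b) * (b - s) + (s - q * h) / 2 * (s * chain_slope N (Suc t) - s * chain_slope N t)"
    unfolding pair_weight_row_sum s r by (simp add: star_weight_def b_def B_def field_simps)
  also have "s * chain_slope N (Suc t) = B * (1 - 1 / h)"
    using h unfolding slope' by (simp add: s_def field_simps power2_eq_square)
  also have "(s - q * h) / 2 * (B * (1 - 1 / h) - s * chain_slope N t)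
      = (h - 1 - q) / 2 * (B * (h - 1) - h * b)"
    using h unfolding slope by (simp add: s_def field_simps power2_eq_square)
  finally have row: "(\<Sum>i<t. pair_weight N i t)
      = (B - b) * (b - s) + (h - 1 - q) / 2 * (B * (h - 1) - h * b)" .
  have "h * s * (B / h\<^sup>2) = (h - 1) * B"
    using h unfolding s_def by (simp add: field_simps power2_eq_square)
  then have col: "(\<Sum>k=Suc t..N. pair_weight N t k)
      = (A - B) * (B - b - h) + h * s * w - (h - 1) * B"
    unfolding pair_weight_column_sum[OF tN] s slope'
    by (simp add: A_def B_def b_def h_def w_def star_weight_def right_diff_distrib)
  have "2 * ((B - b)\<^sup>2 + ((B - b) * (b - s) + (h - 1 - q) / 2 * (B * (h - 1) - h * b))
      + ((A - B) * (B - b - h) + h * s * w - (h - 1) * B) - 2 * B)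
    = (B * (2 * A - h\<^sup>2 - (q * h + 1 - q)) - h\<^sup>2 * (2 * A - w * (h\<^sup>2 - (q * h + 1 - q))))
      - (b * (2 * A - s - q * h) - s * (2 * A - w * (s - q * h)))"
    unfolding s_def by (simp add: power2_eq_square field_simps)
  then have "(B - b)\<^sup>2 + ((B - b) * (b - s) + (h - 1 - q) / 2 * (B * (h - 1) - h * b))
      + ((A - B) * (B - b - h) + h * s * w - (h - 1) * B) = 2 * B"
    unfolding eqs by simp
  then show ?thesis
    unfolding row col using tN by (simp add: star_weight_def b_def B_def)
qed

section \<open>The fast gradient method\<close>

text \<open>For \<open>k \<ge> 1\<close> the point \<open>y k\<close> is the mean of \<open>z 1, \<dots>, z k\<close> with weights
  \<open>theta 0, \<dots>, theta (k - 1)\<close>, and \<open>x k\<close> is the same mean with \<open>z k\<close>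
  carrying the additional weight \<open>theta k\<close>. A gradient with index \<open>i\<close> is missing from
  the part \<open>theta_sum i\<close> of the total weight, which explains the coefficients.\<close>

lemma FGM_displacement:
  assumes FGM: "is_FGM L f N x y z" and "k \<le> N"
  shows "x 0 - y k = (\<Sum>i<k. (theta i * (1 - theta_sum i / theta_sum k) / L) *\<^sub>R gradient f (x i))" (is ?Y)
    and "x 0 - x k = (\<Sum>i<k. (theta i * (1 - theta_sum i / theta_sum (Suc k)) / L) *\<^sub>R gradient f (x i))" (is ?X)
proof -
  let ?g = "\<lambda>i. gradient f (x i)"
  have init: "y 0 = x 0" "z 0 = x 0"
    and y: "\<And>k. k < N \<Longrightarrow> y (Suc k) = x k - (1 / L) *\<^sub>R ?g k"
    and z: "\<And>k. k < N \<Longrightarrow> z (Suc k) = z k - (theta k / L) *\<^sub>R ?g k"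
    and x: "\<And>k. k < N \<Longrightarrow> x (Suc k) = (1 - 1 / theta (Suc k)) *\<^sub>R y (Suc k) + (1 / theta (Suc k)) *\<^sub>R z (Suc k)"
    using FGM by (auto simp: is_FGM_def)
  have Z: "x 0 - z k = (\<Sum>i<k. (theta i / L) *\<^sub>R ?g i)" if "k \<le> N" for k
    using that by (induction k) (auto simp: init z algebra_simps)
  have mix: "x 0 - x k = (\<Sum>i<k. (theta i * (1 - theta_sum i / theta_sum (Suc k)) / L) *\<^sub>R ?g i)"
    if k: "k \<le> N" and Y: "x 0 - y k = (\<Sum>i<k. (theta i * (1 - theta_sum i / theta_sum k) / L) *\<^sub>R ?g i)" for k
  proof (cases k)
    case (Suc m)
    let ?t = "theta k"
    have t: "?t \<noteq> 0" using theta_ge_1[of k] by auto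
    have "theta_sum k \<noteq> 0"
      using theta_sum_ge_1[of k] Suc by auto
    then have ratio: "(1 - 1 / ?t) / theta_sum k = 1 / theta_sum (Suc k)"
      using t unfolding theta_sum_eq[of k] theta_sum_Suc_eq
      by (simp add: divide_simps power2_eq_square) (simp add: algebra_simps)
    have coeff: "(1 - 1 / ?t) * (theta i * (1 - theta_sum i / theta_sum k) / L) + (1 / ?t) * (theta i / L)
        = theta i * (1 - theta_sum i / theta_sum (Suc k)) / L" for i
    proof -
      have "(1 - 1 / ?t) * (theta i * (1 - theta_sum i / theta_sum k) / L) + (1 / ?t) * (theta i / L)
        = theta i * (1 - theta_sum i * ((1 - 1 / ?t) / theta_sum k)) / L"
        by (simp add: add_divide_distrib diff_divide_distrib algebra_simps)
      then show ?thesis by (simp add: ratio)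
    qed
    have "x 0 - x k = (1 - 1 / ?t) *\<^sub>R (x 0 - y k) + (1 / ?t) *\<^sub>R (x 0 - z k)"
      using k x[of m] unfolding Suc by (simp add: algebra_simps)
    also have "\<dots> = (\<Sum>i<k. ((1 - 1 / ?t) * (theta i * (1 - theta_sum i / theta_sum k) / L)
        + (1 / ?t) * (theta i / L)) *\<^sub>R ?g i)"
      unfolding Y Z[OF k] by (simp add: scaleR_sum_right sum.distrib scaleR_add_left)
    finally show ?thesis unfolding coeff .
  qed simp
  have Y: "x 0 - y k = (\<Sum>i<k. (theta i * (1 - theta_sum i / theta_sum k) / L) *\<^sub>R ?g i)" if "k \<le> N" for k
    using that
  proof (induction k)
    case (Suc k)
    have t: "theta k \<noteq> 0" using theta_ge_1[of k] by auto
    have "theta k * (1 - theta_sum k / theta_sum (Suc k)) = 1"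
      using t unfolding theta_sum_Suc_eq theta_sum_eq[of k]
      by (simp add: field_simps power2_eq_square)
    moreover have "x 0 - y (Suc k) = (x 0 - x k) + (1 / L) *\<^sub>R ?g k"
      using Suc.prems y[of k] by simp
    ultimately show ?case
      using mix[of k] Suc by simp
  qed (simp add: init)
  show ?Y by (rule Y[OF \<open>k \<le> N\<close>])
  show ?X by (rule mix[OF \<open>k \<le> N\<close> Y[OF \<open>k \<le> N\<close>]])
qed

theorem theorem5p1:
  fixes f :: "'a::{real_inner, complete_space} \<Rightarrow> real"
    and x y z :: "nat \<Rightarrow> 'a"
    and x_star :: 'a
    and L R :: real
    and N :: nat
  assumes nonzero: "\<exists>v::'a. v \<noteq> 0"
    and L_pos: "L > 0"
    and convex: "convex_on UNIV f"
    and differentiable: "\<forall>u. f differentiable (at u)"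
    and smooth: "L_smooth L f"
    and minimizer: "\<forall>u. f x_star \<le> f u"
    and N_pos: "N \<ge> 1"
    and R_nonneg: "R \<ge> 0"
    and start: "norm (x 0 - x_star) \<le> R"
    and FGM: "is_FGM L f N x y z"
  shows "f (y N) - f x_star
    \<le> (L * R\<^sup>2 * (theta (N - 1))\<^sup>2) / (2 * (2 * (\<Sum>j=0..N - 1. theta j ^ 3) + (theta (N - 1))\<^sup>2))"
proof -
  define p where "p t = (if t < N then x t else y N)" for t
  define g where "g t = (1 / L) *\<^sub>R gradient f (p t)" for t
  define \<phi> where "\<phi> t = (f (p t) - f x_star) / L" for t
  have interp: "(f v - f u) / L + inner (u - v) ((1 / L) *\<^sub>R gradient f v)
      + (norm ((1 / L) *\<^sub>R gradient f u - (1 / L) *\<^sub>R gradient f v))\<^sup>2 / 2 \<le> 0" for u v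
  proof -
    have "((f v - f u) + inner (u - v) (gradient f v)
        + (norm (gradient f u - gradient f v))\<^sup>2 / (2 * L)) / L \<le> 0"
      using smooth_convex_interpolation[OF differentiable convex smooth L_pos, of v u] L_pos
      by (intro divide_nonpos_pos) auto
    then show ?thesis
      using L_pos by (simp add: scaleR_diff_right[symmetric] power_mult_distrib add_divide_distrib
          power_divide power2_eq_square)
  qed
  have y_Suc: "y (Suc t) = p t - g t" if "t < N" for t
    using FGM that by (simp add: is_FGM_def p_def g_def)
  (* The last point y N and the points x t obey one formula once the normalisation stops
     growing at theta_sum N. *)
  have displacement: "x 0 - p t = (\<Sum>i<t. (theta i * (1 - theta_sum i / theta_sum (min (Suc t) N))) *\<^sub>R g i)"
    "x 0 - y t = (\<Sum>i<t. (theta i * (1 - theta_sum i / theta_sum (min t N))) *\<^sub>R g i)"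
    if "t \<le> N" for t
    using FGM_displacement[OF FGM that] that
    by (auto simp: p_def g_def min_def intro!: sum.cong)
  have "chain_weight N (Suc N) * \<phi> N \<le> (norm (x 0 - x_star))\<^sup>2 / 2"
  proof (rule weighted_interpolation_bound[where m = "pair_weight N" and c = "star_weight N" and p = p and y = y and g = g])
    fix t assume t: "t \<le> N"
    show "0 \<le> star_weight N t" by (rule star_weight_nonneg[OF N_pos t])
    show "(star_weight N t)\<^sup>2 + (\<Sum>i<t. pair_weight N i t) + (\<Sum>k=Suc t..N. pair_weight N t k)
        = star_weight N t + chain_weight N t + (if t < N then chain_weight N (Suc t) else 0)"
      by (rule pair_weight_balance[OF N_pos t])
    show "\<phi> t \<le> inner (g t) (p t - x_star) - (norm (g t))\<^sup>2 / 2"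
      using interp[of "p t" x_star] gradient_minimizer[OF differentiable smooth L_pos minimizer]
      by (simp add: \<phi>_def g_def[symmetric] inner_diff inner_commute)
    show "star_weight N t *\<^sub>R (x 0 - p t) + chain_weight N t *\<^sub>R (y t - p t)
      = (\<Sum>i<t. (star_weight N t * star_weight N i - pair_weight N i t) *\<^sub>R g i)"
    proof -
      let ?a = "\<lambda>i. theta i * (1 - theta_sum i / theta_sum (min (Suc t) N))"
      let ?b = "\<lambda>i. theta i * (1 - theta_sum i / theta_sum (min t N))"
      have coeff: "star_weight N t * ?a i + chain_weight N t * (?a i - ?b i)
          = star_weight N t * star_weight N i - pair_weight N i t" for i
        by (simp add: pair_weight_def chain_slope_def star_weight_def[of N t] algebra_simps
            diff_divide_distrib)
      have "star_weight N t *\<^sub>R (x 0 - p t) + chain_weight N t *\<^sub>R (y t - p t)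
        = star_weight N t *\<^sub>R (x 0 - p t) + chain_weight N t *\<^sub>R ((x 0 - p t) - (x 0 - y t))"
        by simp
      also have "\<dots> = (\<Sum>i<t. (star_weight N t * ?a i + chain_weight N t * (?a i - ?b i)) *\<^sub>R g i)"
        unfolding displacement[OF t]
        by (simp only: scaleR_sum_right sum.distrib scaleR_add_left sum_subtractf[symmetric]
            scaleR_diff_left[symmetric] scaleR_scaleR)
      finally show ?thesis unfolding coeff .
    qed
  next
    fix t assume t: "t < N"
    have "\<phi> (Suc t) - \<phi> t = (f (p (Suc t)) - f (p t)) / L"
      by (simp add: \<phi>_def diff_divide_distrib)
    then show "\<phi> (Suc t) \<le> \<phi> t - (norm (g t))\<^sup>2 / 2 - (norm (g (Suc t)))\<^sup>2 / 2
        + inner (g (Suc t)) (p (Suc t) - y (Suc t))"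
      using interp[of "p (Suc t)" "p t"] unfolding y_Suc[OF t] g_def[symmetric]
      by (simp add: power2_norm_eq_inner inner_diff inner_add inner_commute add_divide_distrib
          diff_divide_distrib algebra_simps)
  qed (auto simp: chain_weight_def[of N 0] star_weight_def intro: pair_weight_nonneg)
  also have "\<dots> \<le> R\<^sup>2 / 2"
    using start by (intro divide_right_mono power_mono) auto
  finally have bound: "total_weight N * ((f (y N) - f x_star) / L) \<le> R\<^sup>2 / 2"
    by (simp add: chain_weight_def \<phi>_def p_def)
  obtain M where M: "N = Suc M" using N_pos by (cases N) auto
  let ?T = "(theta M)\<^sup>2" and ?C = "2 * (\<Sum>j\<le>M. theta j ^ 3) + (theta M)\<^sup>2"
  have T: "0 < ?T" "theta_sum N = ?T"
    using theta_sum_Suc_eq[of M] theta_sum_ge_1[of N] M by auto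
  let ?s = "theta_sum N"
  have "?C = ?s * ?s + theta_sq_sum N + ?s"
    using cube_sum[of N] T(2) by (simp add: M lessThan_Suc_atMost power2_eq_square)
  moreover have "total_weight N = (?s * ?s + theta_sq_sum N + ?s) / ?s"
    using theta_sum_ge_1[OF N_pos] by (simp add: total_weight_def theta_mean_def add_divide_distrib)
  ultimately have C: "total_weight N = ?C / ?T"
    using T(2) by simp
  have "0 \<le> (\<Sum>j\<le>M. theta j ^ 3)"
    using theta_ge_1 by (intro sum_nonneg zero_le_power) (meson order_trans zero_le_one)
  then have C_pos: "0 < ?C" using T(1) by linarith
  have "\<delta> \<le> L * r * T / (2 * C)" if "C / T * (\<delta> / L) \<le> r / 2" "0 < T" "0 < C" for \<delta> r T C :: real
    using that L_pos by (simp add: field_simps)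
  from this[OF bound[unfolded C] T(1) C_pos] show ?thesis
    by (simp add: M atLeast0AtMost)
qed

end
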